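(* Let $n\ge 1$ and let $H$ and $K$ be two unbiased Bush-type Hadamard matrices of order $4n^2$. Let $L$ be a $(1,-1)$-matrix such that $HK^t=2nL$. Then $L$ is a Bush-type Hadamard matrix.
   Context: $J_k$ denotes the all-ones matrix of order $k$. A Hadamard matrix of order $k$ is a $k\times k$ matrix with entries in $\{-1,1\}$ and pairwise orthogonal rows. Two Hadamard matrices $H,K$ of order $k$ are unbiased if $HK^t=\sqrt{k}\,L$ for some Hadamard matrix $L$. A Bush-type Hadamard matrix of order $4n^2$ is a Hadamard matrix $H=[H_{ij}]_{1\le i,j\le 2n}$ of order $4n^2$, partitioned into $2n\times 2n$ blocks $H_{ij}$, such that $H_{ii}=J_{2n}$ for all $i$ and $H_{ij}J_{2n}=J_{2n}H_{ij}=0$ for all $i\neq j$. *)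

theory Defs
  imports Complex_Main "Jordan_Normal_Form.Matrix"
begin

definition all_ones_mat :: "nat \<Rightarrow> real mat" where
  "all_ones_mat k = mat k k (\<lambda>_. 1)"

definition pm_one_mat :: "nat \<Rightarrow> real mat \<Rightarrow> bool" where
  "pm_one_mat k A \<longleftrightarrow> A \<in> carrier_mat k k \<and> (\<forall>i<k. \<forall>j<k. A $$ (i, j) \<in> {-1, 1})"

definition hadamard_mat :: "nat \<Rightarrow> real mat \<Rightarrow> bool" where
  "hadamard_mat k H \<longleftrightarrow> pm_one_mat k H \<and>
     (\<forall>i<k. \<forall>j<k. i \<noteq> j \<longrightarrow> row H i \<bullet> row H j = 0)"

definition unbiased :: "nat \<Rightarrow> real mat \<Rightarrow> real mat \<Rightarrow> bool" where
  "unbiased k H K \<longleftrightarrow> hadamard_mat k H \<and> hadamard_mat k K \<and>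
     (\<exists>L. hadamard_mat k L \<and> H * transpose_mat K = sqrt (real k) \<cdot>\<^sub>m L)"

text \<open>The block in block position \<open>(i, j)\<close> of a matrix partitioned into blocks of order
  \<open>m\<close>; blocks, like matrix entries, are indexed from 0.\<close>

definition square_block :: "nat \<Rightarrow> real mat \<Rightarrow> nat \<Rightarrow> nat \<Rightarrow> real mat" where
  "square_block m A i j = mat m m (\<lambda>(a, b). A $$ (i * m + a, j * m + b))"

text \<open>The parameter \<open>n\<close> corresponds to order \<open>4 * n\<^sup>2\<close>.\<close>

definition bush_type_hadamard :: "nat \<Rightarrow> real mat \<Rightarrow> bool" where
  "bush_type_hadamard n H \<longleftrightarrow> hadamard_mat (4 * n\<^sup>2) H \<and>
     (\<forall>i<2 * n. square_block (2 * n) H i i = all_ones_mat (2 * n)) \<and>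
     (\<forall>i<2 * n. \<forall>j<2 * n. i \<noteq> j \<longrightarrow>
        square_block (2 * n) H i j * all_ones_mat (2 * n) = 0\<^sub>m (2 * n) (2 * n) \<and>
        all_ones_mat (2 * n) * square_block (2 * n) H i j = 0\<^sub>m (2 * n) (2 * n))"

end

theory Submission
  imports Defs
begin

text \<open>Let \<open>X = I \<otimes> J\<close> be the block diagonal matrix with all-ones diagonal blocks of order
  \<open>m = 2n\<close>. A Hadamard matrix \<open>A\<close> is of Bush type iff \<open>AX = XA = mX\<close>: the diagonal blocks are
  recovered from \<open>A\<^sub>i\<^sub>iJ = mJ\<close> because \<open>m\<close> signs with sum \<open>m\<close> are all \<open>1\<close>. As \<open>X\<close> is symmetric,
  this condition passes from \<open>H\<close> and \<open>K\<close> to \<open>HK\<^sup>t/m\<close>. That \<open>L\<close> is Hadamard is part of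
  unbiasedness, as \<open>L\<close> is determined by \<open>HK\<^sup>t = mL\<close>.\<close>

text \<open>This is \<open>X\<close> with \<open>m\<close> diagonal blocks of order
  \<open>m\<close>: two indices belong to the same block exactly when their quotients by
  \<open>m\<close> agree.\<close>

definition block_ones :: "nat \<Rightarrow> real mat" where
  "block_ones m = mat (m * m) (m * m) (\<lambda>(i, j). if i div m = j div m then 1 else 0)"

lemma block_ones_carrier [simp]: "block_ones m \<in> carrier_mat (m * m) (m * m)"
  by (simp add: block_ones_def)

lemma transpose_block_ones [simp]: "transpose_mat (block_ones m) = block_ones m"
  by (rule eq_matI) (auto simp: block_ones_def)

lemma all_ones_carrier [simp]: "all_ones_mat m \<in> carrier_mat m m"
  by (simp add: all_ones_mat_def)

lemma square_block_carrier [simp]: "square_block m A i j \<in> carrier_mat m m"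
  by (simp add: square_block_def)

lemma block_index_less: "i * m + a < m * m" if "i < m" "a < m" for i a m :: nat
proof -
  have "i * m + a < Suc i * m" using that by simp
  also have "\<dots> \<le> m * m" using that by (intro mult_le_mono1) simp
  finally show ?thesis .
qed

text \<open>The indices with quotient \<open>i\<close> correspond to their remainders modulo
  \<open>m\<close>. This collapses the sum in an entry of a product with \<open>X\<close> to a
  single block.\<close>

lemma sum_if_div_eq:
  fixes f :: "nat \<Rightarrow> 'a::comm_monoid_add"
  assumes "i < m"
  shows "(\<Sum>k = 0..<m * m. if k div m = i then f k else 0) = (\<Sum>b = 0..<m. f (i * m + b))"
proof -
  have "(\<Sum>k = 0..<m * m. if k div m = i then f k else 0) = sum f {k \<in> {0..<m * m}. k div m = i}"
    by (rule sum.inter_filter[symmetric]) simp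
  also have "\<dots> = (\<Sum>b = 0..<m. f (i * m + b))"
    using assms
    by (intro sum.reindex_bij_witness[of _ "\<lambda>b. i * m + b" "\<lambda>k. k mod m"])
       (auto simp: block_index_less)
  finally show ?thesis .
qed

text \<open>Division with remainder writes every index as a block number and an offset, so the
  blocks cover all entries. Matrix equations involving \<open>X\<close> can thus be checked block by
  block.\<close>

lemma eq_mat_iff_square_blocks:
  assumes A: "A \<in> carrier_mat (m * m) (m * m)" and B: "B \<in> carrier_mat (m * m) (m * m)"
  shows "A = B \<longleftrightarrow> (\<forall>i<m. \<forall>j<m. square_block m A i j = square_block m B i j)"
proof (intro iffI)
  assume blocks: "\<forall>i<m. \<forall>j<m. square_block m A i j = square_block m B i j"
  show "A = B"
  proof (rule eq_matI)
    fix r c assume "r < dim_row B" "c < dim_col B"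
    then have rc: "r < m * m" "c < m * m" using B by auto
    \<comment> \<open>Positivity ensures that the remainders \<open>r mod m\<close> and
      \<open>c mod m\<close> are valid indices within a block.\<close>
    then have m: "m > 0" by (cases m) auto
    have div: "r div m < m" "c div m < m"
      using rc by (simp_all add: less_mult_imp_div_less)
    have "square_block m A (r div m) (c div m) $$ (r mod m, c mod m)
        = square_block m B (r div m) (c div m) $$ (r mod m, c mod m)"
      using blocks div by simp
    then show "A $$ (r, c) = B $$ (r, c)"
      using m by (simp add: square_block_def)
  qed (use A B in auto)
qed simp

lemma square_block_block_ones:
  assumes "i < m" "j < m"
  shows "square_block m (block_ones m) i j = (if i = j then all_ones_mat m else 0\<^sub>m m m)"
  using assms
  by (intro eq_matI) (auto simp: square_block_def block_ones_def all_ones_mat_def block_index_less)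

lemma square_block_smult:
  assumes "A \<in> carrier_mat (m * m) (m * m)" "i < m" "j < m"
  shows "square_block m (c \<cdot>\<^sub>m A) i j = c \<cdot>\<^sub>m square_block m A i j"
  using assms by (intro eq_matI) (auto simp: square_block_def block_index_less)

text \<open>A column of \<open>X\<close> in block column \<open>j\<close> is the indicator of the
  \<open>j\<close>-th block of indices, so an entry of the product is a row sum over one block of
  \<open>A\<close>.\<close>

lemma square_block_mult_block_ones:
  assumes A: "A \<in> carrier_mat (m * m) (m * m)" and ij: "i < m" "j < m"
  shows "square_block m (A * block_ones m) i j = square_block m A i j * all_ones_mat m"
proof (rule eq_matI)
  fix a b
  assume "a < dim_row (square_block m A i j * all_ones_mat m)"
    "b < dim_col (square_block m A i j * all_ones_mat m)"
  then have ab: "a < m" "b < m" by (auto simp: square_block_def all_ones_mat_def)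
  have "square_block m (A * block_ones m) i j $$ (a, b)
      = (\<Sum>k = 0..<m * m. if k div m = j then A $$ (i * m + a, k) else 0)"
    using A ij ab
    by (auto simp: square_block_def block_ones_def scalar_prod_def block_index_less intro!: sum.cong)
  also have "\<dots> = (\<Sum>k = 0..<m. A $$ (i * m + a, j * m + k))"
    by (rule sum_if_div_eq) fact
  also have "\<dots> = (square_block m A i j * all_ones_mat m) $$ (a, b)"
    using ab by (simp add: square_block_def all_ones_mat_def scalar_prod_def)
  finally show "square_block m (A * block_ones m) i j $$ (a, b)
      = (square_block m A i j * all_ones_mat m) $$ (a, b)" .
qed (auto simp: square_block_def all_ones_mat_def)

text \<open>The mirror image: rows of \<open>X\<close> are block indicators too, so column sums
  within one block of \<open>A\<close> appear.\<close>

lemma square_block_block_ones_mult: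
  assumes A: "A \<in> carrier_mat (m * m) (m * m)" and ij: "i < m" "j < m"
  shows "square_block m (block_ones m * A) i j = all_ones_mat m * square_block m A i j"
proof (rule eq_matI)
  fix a b
  assume "a < dim_row (all_ones_mat m * square_block m A i j)"
    "b < dim_col (all_ones_mat m * square_block m A i j)"
  then have ab: "a < m" "b < m" by (auto simp: square_block_def all_ones_mat_def)
  have "square_block m (block_ones m * A) i j $$ (a, b)
      = (\<Sum>k = 0..<m * m. if k div m = i then A $$ (k, j * m + b) else 0)"
    using A ij ab
    by (auto simp: square_block_def block_ones_def scalar_prod_def block_index_less intro!: sum.cong)
  also have "\<dots> = (\<Sum>k = 0..<m. A $$ (i * m + k, j * m + b))"
    by (rule sum_if_div_eq) fact
  also have "\<dots> = (all_ones_mat m * square_block m A i j) $$ (a, b)"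
    using ab by (simp add: square_block_def all_ones_mat_def scalar_prod_def)
  finally show "square_block m (block_ones m * A) i j $$ (a, b)
      = (all_ones_mat m * square_block m A i j) $$ (a, b)" .
qed (auto simp: square_block_def all_ones_mat_def)

lemma all_ones_mult_all_ones: "all_ones_mat m * all_ones_mat m = real m \<cdot>\<^sub>m all_ones_mat m"
  by (rule eq_matI) (auto simp: all_ones_mat_def scalar_prod_def)

text \<open>Comparing blocks turns the single equation into the off-diagonal Bush condition together
  with a row sum condition on the diagonal blocks.\<close>

lemma mult_block_ones_eq_iff:
  assumes A: "A \<in> carrier_mat (m * m) (m * m)"
  shows "A * block_ones m = real m \<cdot>\<^sub>m block_ones m \<longleftrightarrow>
    (\<forall>i<m. \<forall>j<m. square_block m A i j * all_ones_mat m =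
      (if i = j then real m \<cdot>\<^sub>m all_ones_mat m else 0\<^sub>m m m))"
  using A
  by (subst eq_mat_iff_square_blocks[where m = m])
     (auto simp: square_block_mult_block_ones square_block_smult square_block_block_ones mult_carrier_mat[OF _ block_ones_carrier])

lemma block_ones_mult_eq_iff:
  assumes A: "A \<in> carrier_mat (m * m) (m * m)"
  shows "block_ones m * A = real m \<cdot>\<^sub>m block_ones m \<longleftrightarrow>
    (\<forall>i<m. \<forall>j<m. all_ones_mat m * square_block m A i j =
      (if i = j then real m \<cdot>\<^sub>m all_ones_mat m else 0\<^sub>m m m))"
  using A
  by (subst eq_mat_iff_square_blocks[where m = m])
     (auto simp: square_block_block_ones_mult square_block_smult square_block_block_ones mult_carrier_mat[OF block_ones_carrier])

lemma pm_one_mult_all_ones_eqD: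
  assumes B: "pm_one_mat m B" and eq: "B * all_ones_mat m = real m \<cdot>\<^sub>m all_ones_mat m"
  shows "B = all_ones_mat m"
proof (rule eq_matI)
  fix a b assume "a < dim_row (all_ones_mat m)" "b < dim_col (all_ones_mat m)"
  then have ab: "a < m" "b < m" by (auto simp: all_ones_mat_def)
  have "(B * all_ones_mat m) $$ (a, b) = real m"
    unfolding eq using ab by (simp add: all_ones_mat_def)
  then have "(\<Sum>k = 0..<m. B $$ (a, k)) = real m"
    using B ab by (auto simp: pm_one_mat_def all_ones_mat_def scalar_prod_def)
  \<comment> \<open>The defects \<open>1 - B $$ (a, k)\<close> are nonnegative because the entries
    are signs, so a vanishing sum forces each of them to vanish.\<close>
  then have "(\<Sum>k = 0..<m. 1 - B $$ (a, k)) = 0"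
    by (simp add: sum_subtractf)
  moreover have "\<forall>k\<in>{0..<m}. 0 \<le> 1 - B $$ (a, k)"
    using B ab by (force simp: pm_one_mat_def)
  ultimately have "\<forall>k\<in>{0..<m}. 1 - B $$ (a, k) = 0"
    by (subst (asm) sum_nonneg_eq_0_iff) auto
  then show "B $$ (a, b) = all_ones_mat m $$ (a, b)"
    using ab by (simp add: all_ones_mat_def)
qed (use B in \<open>auto simp: pm_one_mat_def all_ones_mat_def\<close>)

lemma pm_one_square_block:
  assumes "pm_one_mat (m * m) A" "i < m" "j < m"
  shows "pm_one_mat m (square_block m A i j)"
  using assms by (auto simp: pm_one_mat_def square_block_def block_index_less)

lemma bush_type_hadamard_iff:
  fixes n :: nat
  defines "m \<equiv> 2 * n"
  shows "bush_type_hadamard n A \<longleftrightarrow> hadamard_mat (m * m) A \<and>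
    A * block_ones m = real m \<cdot>\<^sub>m block_ones m \<and> block_ones m * A = real m \<cdot>\<^sub>m block_ones m"
\<comment> \<open>Both sides include the Hadamard condition. When it holds, it supplies the
  dimensions and the signs for the block lemmas; otherwise both sides are false.\<close>
proof (cases "hadamard_mat (m * m) A")
  case True
  have order: "4 * n\<^sup>2 = m * m"
    by (simp add: m_def power2_eq_square)
  have pm: "pm_one_mat (m * m) A"
    using True by (simp add: hadamard_mat_def)
  then have A: "A \<in> carrier_mat (m * m) (m * m)"
    by (simp add: pm_one_mat_def)
  have diag: "square_block m A i i = all_ones_mat m \<longleftrightarrow>
      square_block m A i i * all_ones_mat m = real m \<cdot>\<^sub>m all_ones_mat m \<and>
      all_ones_mat m * square_block m A i i = real m \<cdot>\<^sub>m all_ones_mat m" if "i < m" for i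
    using pm_one_mult_all_ones_eqD[OF pm_one_square_block[OF pm that that]]
    by (auto simp: all_ones_mult_all_ones)
  show ?thesis
    unfolding bush_type_hadamard_def order m_def[symmetric]
      mult_block_ones_eq_iff[OF A] block_ones_mult_eq_iff[OF A]
    using True diag by (auto split: if_splits)
next
  case False
  then show ?thesis
    by (simp add: bush_type_hadamard_def m_def power2_eq_square)
qed

lemma transpose_mat_smult: "transpose_mat (c \<cdot>\<^sub>m A) = c \<cdot>\<^sub>m transpose_mat A"
  by (rule eq_matI) auto

text \<open>Scaling preserves dimensions, so those of \<open>A\<close> and \<open>B\<close> can be
  read off from the equation; the entries follow by cancelling \<open>c\<close>.\<close>

lemma smult_mat_cancel:
  fixes c :: "'a::field"
  assumes "c \<noteq> 0" and eq: "c \<cdot>\<^sub>m A = c \<cdot>\<^sub>m B"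
  shows "A = B"
proof (rule eq_matI)
  show dims: "dim_row A = dim_row B" "dim_col A = dim_col B"
    using arg_cong[OF eq, of dim_row] arg_cong[OF eq, of dim_col] by simp_all
  fix i j assume "i < dim_row B" "j < dim_col B"
  then show "A $$ (i, j) = B $$ (i, j)"
    using arg_cong[OF eq, of "\<lambda>M. M $$ (i, j)"] dims \<open>c \<noteq> 0\<close> by simp
qed

theorem lemma3p2:
  fixes n :: nat and H K L :: "real mat"
  assumes "n \<ge> 1"
    and "bush_type_hadamard n H" and "bush_type_hadamard n K"
    and "unbiased (4 * n\<^sup>2) H K"
    and "pm_one_mat (4 * n\<^sup>2) L"
    and "H * transpose_mat K = (2 * real n) \<cdot>\<^sub>m L"
  shows "bush_type_hadamard n L"
proof -
  define m where "m = 2 * n"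
  define X where "X = block_ones m"
  have order: "4 * n\<^sup>2 = m * m"
    by (simp add: m_def power2_eq_square)
  have m: "real m \<noteq> 0"
    using \<open>n \<ge> 1\<close> by (simp add: m_def)
  have HKL: "H * transpose_mat K = real m \<cdot>\<^sub>m L"
    using assms(6) by (simp add: m_def)
  have X: "X \<in> carrier_mat (m * m) (m * m)" and X_sym: "transpose_mat X = X"
    by (simp_all add: X_def)
  have H: "hadamard_mat (m * m) H" "H * X = real m \<cdot>\<^sub>m X" "X * H = real m \<cdot>\<^sub>m X"
    using assms(2) unfolding bush_type_hadamard_iff X_def m_def by blast+
  have K: "hadamard_mat (m * m) K" "K * X = real m \<cdot>\<^sub>m X" "X * K = real m \<cdot>\<^sub>m X"
    using assms(3) unfolding bush_type_hadamard_iff X_def m_def by blast+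
  have Hc: "H \<in> carrier_mat (m * m) (m * m)" and Kc: "K \<in> carrier_mat (m * m) (m * m)"
    using H(1) K(1) by (auto simp: hadamard_mat_def pm_one_mat_def)
  have Ktc: "transpose_mat K \<in> carrier_mat (m * m) (m * m)"
    using Kc by simp
  have Lc: "L \<in> carrier_mat (m * m) (m * m)"
    using assms(5) unfolding order by (simp add: pm_one_mat_def)
  obtain L' where L': "hadamard_mat (m * m) L'"
      "H * transpose_mat K = sqrt (real (m * m)) \<cdot>\<^sub>m L'"
    using assms(4) unfolding unbiased_def order by blast
  \<comment> \<open>The square root of the order \<open>m * m\<close> is \<open>m\<close>, so both
    sides equal HK^t.\<close>
  then have "real m \<cdot>\<^sub>m L = real m \<cdot>\<^sub>m L'"
    using HKL by simp
  then have "L = L'"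
    by (rule smult_mat_cancel[OF m])
  then have had: "hadamard_mat (m * m) L"
    using L'(1) by simp
  \<comment> \<open>Transposition exchanges the left and right conditions: this is the transpose of
    \<open>X * K = real m \<cdot>\<^sub>m X\<close>, as \<open>X\<close> is symmetric.\<close>
  have KtX: "transpose_mat K * X = real m \<cdot>\<^sub>m X"
    using transpose_mult[OF X Kc] K(3) X_sym by (simp add: transpose_mat_smult)
  have XKt: "X * transpose_mat K = real m \<cdot>\<^sub>m X"
    using transpose_mult[OF Kc X] K(2) X_sym by (simp add: transpose_mat_smult)
  \<comment> \<open>\<open>X\<close> absorbs first K^t and then \<open>H\<close>, each contributing
    a factor \<open>m\<close>; one of the two cancels against the factor on the left.\<close>
  have "real m \<cdot>\<^sub>m (L * X) = (H * transpose_mat K) * X"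
    using HKL mult_smult_assoc_mat[OF Lc X] by simp
  also have "\<dots> = H * (transpose_mat K * X)"
    by (rule assoc_mult_mat[OF Hc Ktc X])
  also have "\<dots> = real m \<cdot>\<^sub>m (real m \<cdot>\<^sub>m X)"
    using mult_smult_distrib[OF Hc X] by (simp add: KtX H(2))
  finally have LX: "L * X = real m \<cdot>\<^sub>m X"
    by (rule smult_mat_cancel[OF m])
  \<comment> \<open>From the other side, \<open>X\<close> absorbs \<open>H\<close> first and then
    K^t.\<close>
  have "real m \<cdot>\<^sub>m (X * L) = X * (H * transpose_mat K)"
    using HKL mult_smult_distrib[OF X Lc] by simp
  also have "\<dots> = (X * H) * transpose_mat K"
    by (rule assoc_mult_mat[OF X Hc Ktc, symmetric])
  also have "\<dots> = real m \<cdot>\<^sub>m (real m \<cdot>\<^sub>m X)"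
    using mult_smult_assoc_mat[OF X Ktc] by (simp add: XKt H(3))
  finally have XL: "X * L = real m \<cdot>\<^sub>m X"
    by (rule smult_mat_cancel[OF m])
  show ?thesis
    using had LX XL unfolding bush_type_hadamard_iff X_def m_def by blast
qed

end
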